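(* Let $(X,\sigma_X)$ be a subshift. Let $\mathcal F=\{\log f_n\}_{n=1}^\infty$ be a sequence on $X$ with tempered variation such that $\{\log(e^Cf_n)\}_{n=1}^\infty$ is subadditive for some $C\ge0$. Suppose that there exist $k,N\in\mathbb N$ and a sequence $\{M_n\}_{n=1}^\infty$ of positive real numbers with $\lim_{n\to\infty}\frac1n\log M_n=0$ such that for any $u\in B_n(X)$, $n\ge N$, there exist $0\le q\le k$ and $w\in B_q(X)$ such that $z:=(uw)^\infty$ is a point in $X$ satisfying $$f_{j(n+q)}(z)\ge\left(M_n\sup\{f_n(x):x\in[u]\}\right)^j\quad\text{for every }j\in\mathbb N.$$ Then the following statements are equivalent for $h\in C(X)$. (i) $\mathcal F$ is asymptotically additive on $X$ and satisfies $\lim_{n\to\infty}\frac1n\left\lVert\log\left(\frac{f_n}{e^{S_nh}}\right)\right\rVert_\infty=0$. (ii) $\lim_{n\to\infty}\frac1n\int\log f_n\,d\mu=\int h\,d\mu>-\infty$ for every $\mu\in M(X,\sigma_X)$. (iii) $\lim_{n\to\infty}\frac1n\log\left(\frac{f_n(x)}{e^{(S_nh)(x)}}\right)=0$ for every periodic point $x\in X$. (iv) $\lim_{n\to\infty}\frac1n\log\left(\frac{f_n(x)}{e^{(S_nh)(x)}}\right)=0$ for every $x\in X$.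
   Context: $\mathbb N=\{1,2,\dots\}$. A (one-sided) subshift $(X,\sigma_X)$ is a closed set $X\subseteq\{1,\dots,k\}^{\mathbb N}$ (some $k\ge1$) with $\sigma_X(X)\subseteq X$, where $(\sigma_Xx)_i=x_{i+1}$. $B_n(X)$ is the set of words of length $n$ appearing in points of $X$; $B_0(X)=\{\epsilon\}$ with $\epsilon$ the empty word. The cylinder $[x_1\dots x_n]$ is the set of $z\in X$ with $z_i=x_i$ for $1\le i\le n$. $(uw)^\infty$ is the infinite periodic repetition of the word $uw$. $x$ is periodic if $\sigma_X^lx=x$ for some $l\in\mathbb N$. $M(X,\sigma_X)$ is the set of $\sigma_X$-invariant Borel probability measures. $(S_nh)(x)=\sum_{i=0}^{n-1}h(\sigma_X^ix)$; $\lVert\cdot\rVert_\infty$ is the supremum norm. A sequence $\mathcal F=\{\log f_n\}_{n=1}^\infty$ on $X$ consists of continuous $f_n:X\to(0,\infty)$. It is subadditive if $f_{n+m}(x)\le f_n(x)f_m(\sigma_X^nx)$ for all $n,m\in\mathbb N$, $x\in X$. It has tempered variation if $\lim_{n\to\infty}\frac1n\log\sup\{f_n(x)/f_n(y):x,y\in X,\ x_i=y_i\text{ for }1\le i\le n\}=0$. It is asymptotically additive if for every $\epsilon>0$ there is a continuous function $\rho_\epsilon$ on $X$ with $\limsup_{n\to\infty}\frac1n\lVert\log f_n-S_n\rho_\epsilon\rVert_\infty<\epsilon$. *)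

theory Defs
  imports "HOL-Analysis.Analysis" "HOL-Probability.Probability_Measure"
begin

text \<open>
  A point \<open>(x_1, x_2, \<dots>)\<close> is a function \<open>x :: nat \<Rightarrow> nat\<close> with \<open>x_i = x (i - 1)\<close>, so positions
  start at 0.  The type \<open>nat \<Rightarrow> nat\<close> carries the product of the discrete topologies.
  Sequences \<open>f :: nat \<Rightarrow> _\<close> written \<open>f_1, f_2, \<dots>\<close> are only constrained at indices \<open>n \<ge> 1\<close>, and
  functions on a subshift \<open>X\<close> are total functions of which only the values on \<open>X\<close> matter.
\<close>

definition left_shift :: "(nat \<Rightarrow> nat) \<Rightarrow> nat \<Rightarrow> nat" where
  "left_shift x = (\<lambda>i. x (Suc i))"

text \<open>\<open>{1..k}\<^sup>\<nat>\<close> is closed in \<open>nat \<Rightarrow> nat\<close>, so \<open>closed X\<close> means closed in the full shift.\<close>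

definition subshift :: "(nat \<Rightarrow> nat) set \<Rightarrow> bool" where
  "subshift X \<longleftrightarrow>
     (\<exists>k\<ge>1. X \<subseteq> UNIV \<rightarrow> {1..k}) \<and> closed X \<and> left_shift ` X \<subseteq> X"

text \<open>The case \<open>n = 0\<close> is separate only because of \<open>X = {}\<close>.\<close>

definition words :: "(nat \<Rightarrow> nat) set \<Rightarrow> nat \<Rightarrow> nat list set" where
  "words X n = (if n = 0 then {[]} else {map x [i..<i + n] | x i. x \<in> X})"

definition cylinder :: "(nat \<Rightarrow> nat) set \<Rightarrow> nat list \<Rightarrow> (nat \<Rightarrow> nat) set" where
  "cylinder X u = {z \<in> X. \<forall>i<length u. z i = u ! i}"

definition repeat_word :: "nat list \<Rightarrow> nat \<Rightarrow> nat" where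
  "repeat_word u = (\<lambda>i. u ! (i mod length u))"

definition periodic_point :: "(nat \<Rightarrow> nat) \<Rightarrow> bool" where
  "periodic_point x \<longleftrightarrow> (\<exists>l\<ge>1. (left_shift ^^ l) x = x)"

definition invariant_measures :: "(nat \<Rightarrow> nat) set \<Rightarrow> (nat \<Rightarrow> nat) measure set" where
  "invariant_measures X =
     {\<mu>. prob_space \<mu> \<and> sets \<mu> = sets (restrict_space borel X) \<and>
         (\<forall>A\<in>sets \<mu>. emeasure \<mu> (left_shift -` A \<inter> space \<mu>) = emeasure \<mu> A)}"

definition birkhoff_sum :: "((nat \<Rightarrow> nat) \<Rightarrow> real) \<Rightarrow> nat \<Rightarrow> (nat \<Rightarrow> nat) \<Rightarrow> real" where
  "birkhoff_sum h n x = (\<Sum>i<n. h ((left_shift ^^ i) x))"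

text \<open>Only used for functions that are continuous on a compact set, where the set is bounded.\<close>

definition sup_norm_on :: "(nat \<Rightarrow> nat) set \<Rightarrow> ((nat \<Rightarrow> nat) \<Rightarrow> real) \<Rightarrow> real" where
  "sup_norm_on X g = (SUP x\<in>X. \<bar>g x\<bar>)"

text \<open>
  A sequence \<open>{log f_n}\<close> is represented by \<open>f\<close> itself; the following notions refer to \<open>{log f_n}\<close>.
\<close>

definition log_sequence_on :: "(nat \<Rightarrow> nat) set \<Rightarrow> (nat \<Rightarrow> (nat \<Rightarrow> nat) \<Rightarrow> real) \<Rightarrow> bool" where
  "log_sequence_on X f \<longleftrightarrow> (\<forall>n\<ge>1. continuous_on X (f n) \<and> (\<forall>x\<in>X. f n x > 0))"

definition subadditive_on :: "(nat \<Rightarrow> nat) set \<Rightarrow> (nat \<Rightarrow> (nat \<Rightarrow> nat) \<Rightarrow> real) \<Rightarrow> bool" where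
  "subadditive_on X f \<longleftrightarrow>
     (\<forall>n\<ge>1. \<forall>m\<ge>1. \<forall>x\<in>X. f (n + m) x \<le> f n x * f m ((left_shift ^^ n) x))"

definition tempered_variation_on :: "(nat \<Rightarrow> nat) set \<Rightarrow> (nat \<Rightarrow> (nat \<Rightarrow> nat) \<Rightarrow> real) \<Rightarrow> bool" where
  "tempered_variation_on X f \<longleftrightarrow>
     (\<lambda>n. 1 / real n * ln (Sup {f n x / f n y | x y. x \<in> X \<and> y \<in> X \<and> (\<forall>i<n. x i = y i)}))
       \<longlonglongrightarrow> 0"

definition asymptotically_additive_on ::
    "(nat \<Rightarrow> nat) set \<Rightarrow> (nat \<Rightarrow> (nat \<Rightarrow> nat) \<Rightarrow> real) \<Rightarrow> bool" where
  "asymptotically_additive_on X f \<longleftrightarrow>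
     (\<forall>\<epsilon>>0. \<exists>\<rho>. continuous_on X \<rho> \<and>
        limsup (\<lambda>n. ereal (1 / real n * sup_norm_on X (\<lambda>x. ln (f n x) - birkhoff_sum \<rho> n x)))
          < ereal \<epsilon>)"

end

theory Submission
  imports Defs "HOL-Probability.Probability_Mass_Function" "HOL-Real_Asymp.Real_Asymp"
begin

text \<open>
  Everything is compared with the uniform statement
  \<open>\<parallel>ln f_n - S_n h\<parallel> = o(n)\<close>; the only hard implication is that it follows from (iii).
  Given \<open>x\<close>, apply the hypothesis to \<open>u = x_1 \<dots> x_n\<close> to get a point \<open>z = (uw)\<^sup>\<infinity>\<close> of period
  \<open>p = n + q\<close>.  By (iii), \<open>ln f_{jp}(z) / j\<close> tends to \<open>S_p h(z)\<close>, which is within \<open>O(1)\<close> of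
  \<open>S_n h(z)\<close> and hence within \<open>o(n)\<close> of \<open>S_n h(x)\<close>.  The lower bound on \<open>f_{jp}(z)\<close> gives
  \<open>ln f_n(x) \<le> S_p h(z) + o(n)\<close>; subadditivity gives \<open>S_p h(z) \<le> ln f_p(z) + C \<le> ln f_n(z) + O(1)\<close>,
  and tempered variation replaces \<open>z\<close> by \<open>x\<close>.  For (ii) \<open>\<Longrightarrow>\<close> (iii), integrate against the
  uniform measure on a periodic orbit.
\<close>

section \<open>The shift map and continuous functions on a compact subshift\<close>

lemma funpow_left_shift: "(left_shift ^^ n) x = (\<lambda>i. x (i + n))"
  by (induction n) (auto simp: left_shift_def)

lemma subshift_funpow_mem: "subshift X \<Longrightarrow> x \<in> X \<Longrightarrow> (left_shift ^^ n) x \<in> X"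
  by (induction n) (auto simp: subshift_def)

text \<open>By Tychonoff, the full shift over a finite alphabet is compact as a product of finite
  discrete spaces, and \<open>X\<close> is a closed part of it.\<close>

lemma compact_subshift:
  assumes "subshift X"
  shows "compact X"
proof -
  obtain k where k: "X \<subseteq> UNIV \<rightarrow> {1..k}" and "closed X"
    using assms by (auto simp: subshift_def)
  have "compactin (product_topology (\<lambda>_::nat. euclidean :: nat topology) UNIV)
          (PiE UNIV (\<lambda>_. {1..k}))"
    by (subst compactin_PiE) (auto intro: finite_imp_compact)
  then have "compact (PiE UNIV (\<lambda>_::nat. {1..k}))"
    by (simp add: euclidean_product_topology)
  then have "compact (PiE UNIV (\<lambda>_::nat. {1..k}) \<inter> X)"
    using \<open>closed X\<close> by (rule compact_Int_closed)
  moreover have "PiE UNIV (\<lambda>_::nat. {1..k}) \<inter> X = X"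
    using k by (auto simp: PiE_def)
  ultimately show ?thesis by simp
qed

lemma continuous_on_funpow_left_shift: "continuous_on S (left_shift ^^ n)"
proof (rule continuous_on_coordinatewise_then_product)
  fix i
  show "continuous_on S (\<lambda>x. (left_shift ^^ n) x i)"
    unfolding funpow_left_shift
    by (rule continuous_on_subset[OF continuous_on_product_coordinates]) auto
qed

lemma continuous_on_comp_funpow:
  assumes "subshift X" "continuous_on X h"
  shows "continuous_on X (\<lambda>x. h ((left_shift ^^ i) x))"
  by (rule continuous_on_compose2[OF assms(2) continuous_on_funpow_left_shift])
     (use subshift_funpow_mem[OF assms(1)] in auto)

lemma continuous_on_birkhoff_sum:
  assumes "subshift X" "continuous_on X h"
  shows "continuous_on X (birkhoff_sum h n)"
  unfolding birkhoff_sum_def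
  by (intro continuous_on_sum continuous_on_comp_funpow assms)

lemma continuous_on_subshift_bounded:
  fixes h :: "(nat \<Rightarrow> nat) \<Rightarrow> real"
  assumes "subshift X" "continuous_on X h"
  obtains B where "B > 0" "\<And>x. x \<in> X \<Longrightarrow> \<bar>h x\<bar> \<le> B"
proof -
  have "bounded (h ` X)"
    using assms compact_subshift compact_continuous_image compact_imp_bounded by blast
  then show thesis
    using that by (auto simp: bounded_pos)
qed

lemma abs_le_sup_norm_on:
  assumes "subshift X" "continuous_on X g" "x \<in> X"
  shows "\<bar>g x\<bar> \<le> sup_norm_on X g"
proof -
  obtain B where B: "\<And>x. x \<in> X \<Longrightarrow> \<bar>g x\<bar> \<le> B"
    using continuous_on_subshift_bounded[OF assms(1,2)] by blast
  have "bdd_above ((\<lambda>x. \<bar>g x\<bar>) ` X)"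
    by (rule bdd_aboveI2[OF B])
  then show ?thesis
    unfolding sup_norm_on_def using assms(3) by (rule cSUP_upper2) auto
qed

text \<open>A bound that is uniform on \<open>X\<close> passes to the supremum. It is applied with
  \<open>e / 2\<close>, because convergence asks for a strict inequality.\<close>

lemma sup_norm_on_average_tendsto_0:
  assumes small: "\<And>e. e > 0 \<Longrightarrow> \<forall>\<^sub>F n in sequentially. \<forall>x\<in>X. \<bar>g n x\<bar> \<le> e * real n"
  shows "(\<lambda>n. 1 / real n * sup_norm_on X (g n)) \<longlonglongrightarrow> 0"
proof (cases "X = {}")
  \<comment> \<open>The supremum over the empty set is some fixed real, the same for every
    \<open>n\<close>, so dividing by \<open>n\<close> sends it to 0.\<close>
  case True
  then show ?thesis
    unfolding sup_norm_on_def by (simp add: lim_const_over_n)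
next
  case False
  show ?thesis
  proof (rule tendstoI)
    fix e :: real assume "e > 0"
    have "\<forall>\<^sub>F n in sequentially. \<forall>x\<in>X. \<bar>g n x\<bar> \<le> e / 2 * real n"
      using \<open>e > 0\<close> by (intro small) simp
    then show "\<forall>\<^sub>F n in sequentially. dist (1 / real n * sup_norm_on X (g n)) 0 < e"
      using eventually_gt_at_top[of 0]
    proof eventually_elim
      case (elim n)
      \<comment> \<open>A single point of \<open>X\<close> forces the supremum to be nonnegative, so
        the upper bound also controls its absolute value.\<close>
      obtain x0 where "x0 \<in> X" using False by auto
      have "sup_norm_on X (g n) \<le> e / 2 * real n"
        unfolding sup_norm_on_def using elim False by (intro cSUP_least) auto
      moreover have "\<bar>g n x0\<bar> \<le> sup_norm_on X (g n)"
        unfolding sup_norm_on_def using \<open>x0 \<in> X\<close> elim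
        by (intro cSUP_upper bdd_aboveI2[where M = "e / 2 * real n"]) auto
      moreover have "e / 2 * real n < e * real n"
        using \<open>e > 0\<close> elim by simp
      ultimately have "0 \<le> sup_norm_on X (g n)" "sup_norm_on X (g n) < e * real n"
        by linarith+
      then show ?case
        using elim by (simp add: field_simps)
    qed
  qed
qed

section \<open>Birkhoff sums, in particular along periodic orbits\<close>

lemma birkhoff_sum_add:
  "birkhoff_sum h (n + m) x = birkhoff_sum h n x + birkhoff_sum h m ((left_shift ^^ n) x)"
proof -
  have "birkhoff_sum h (n + m) x
      = birkhoff_sum h n x + (\<Sum>i<m. h ((left_shift ^^ (n + i)) x))"
    unfolding birkhoff_sum_def by (induction m) auto
  then show ?thesis
    by (simp add: birkhoff_sum_def funpow_left_shift add_ac)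
qed

lemma funpow_mult_periodic: "(f ^^ p) x = x \<Longrightarrow> (f ^^ (j * p)) x = x"
  by (induction j) (auto simp: funpow_add)

lemma birkhoff_sum_periodic:
  assumes "(left_shift ^^ p) z = z"
  shows "birkhoff_sum h (j * p) z = real j * birkhoff_sum h p z"
proof (induction j)
  case 0
  then show ?case by (simp add: birkhoff_sum_def)
next
  case (Suc j)
  have "birkhoff_sum h (Suc j * p) z = birkhoff_sum h (p + j * p) z"
    by simp
  also have "\<dots> = birkhoff_sum h p z + real j * birkhoff_sum h p z"
    unfolding birkhoff_sum_add using assms Suc by simp
  finally show ?case by (simp add: algebra_simps)
qed

lemma abs_birkhoff_sum_le:
  assumes "subshift X" "\<And>x. x \<in> X \<Longrightarrow> \<bar>h x\<bar> \<le> B" "x \<in> X"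
  shows "\<bar>birkhoff_sum h n x\<bar> \<le> real n * B"
proof -
  have "\<bar>birkhoff_sum h n x\<bar> \<le> (\<Sum>i<n. \<bar>h ((left_shift ^^ i) x)\<bar>)"
    unfolding birkhoff_sum_def by (rule sum_abs)
  also have "\<dots> \<le> (\<Sum>i<n. B)"
    by (intro sum_mono assms(2) subshift_funpow_mem assms)
  finally show ?thesis by simp
qed

section \<open>Cylinders, uniform continuity and the variation of Birkhoff sums\<close>

text \<open>A basic open set of the product topology restricts only finitely many coordinates; a
  prefix of \<open>x\<close> that covers all of them suffices.\<close>

lemma open_fun_contains_cylinder:
  fixes x :: "nat \<Rightarrow> 'a::topological_space"
  assumes "open U" "x \<in> U"
  obtains m where "{z. \<forall>i<m. z i = x i} \<subseteq> U"
proof -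
  obtain W where W: "x \<in> PiE UNIV W" "finite {i. W i \<noteq> UNIV}" "PiE UNIV W \<subseteq> U"
    using product_topology_open_contains_basis[of "\<lambda>_. euclidean" UNIV U x] assms
    unfolding euclidean_product_topology by auto
  obtain m where m: "\<forall>i\<in>{i. W i \<noteq> UNIV}. i < m"
    using W(2) finite_nat_set_iff_bounded by blast
  have "{z. \<forall>i<m. z i = x i} \<subseteq> PiE UNIV W"
  proof (clarsimp simp: PiE_def Pi_def)
    fix z i assume z: "\<forall>i<m. z i = x i"
    show "z i \<in> W i"
    proof (cases "W i = UNIV")
      case False
      then show ?thesis using W(1) z m by (auto simp: PiE_def Pi_def)
    qed simp
  qed
  then show thesis
    using W(3) by (intro that) (rule order_trans)
qed

text \<open>The Heine-Cantor argument with cylinders in place of balls: finitely many cylinders of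
  suitable local lengths cover \<open>X\<close>, and the largest of these lengths works everywhere.
  Both points are compared with the centre of a common cylinder, hence \<open>e / 2\<close>.\<close>

lemma subshift_uniformly_continuous:
  fixes h :: "(nat \<Rightarrow> nat) \<Rightarrow> real"
  assumes "subshift X" "continuous_on X h" "e > 0"
  obtains m where "\<And>x y. x \<in> X \<Longrightarrow> y \<in> X \<Longrightarrow> (\<And>i. i < m \<Longrightarrow> x i = y i) \<Longrightarrow> \<bar>h x - h y\<bar> < e"
proof -
  have "\<exists>m. \<forall>z\<in>X. (\<forall>i<m. z i = x i) \<longrightarrow> \<bar>h z - h x\<bar> < e / 2" if x: "x \<in> X" for x
  proof -
    obtain U where U: "open U" "U \<inter> X = h -` ball (h x) (e / 2) \<inter> X"
      using assms(2) unfolding continuous_on_open_invariant by (metis open_ball)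
    have "x \<in> U" using U x \<open>e > 0\<close> by auto
    obtain m where "{z. \<forall>i<m. z i = x i} \<subseteq> U"
      using open_fun_contains_cylinder[OF U(1) \<open>x \<in> U\<close>] .
    moreover have "\<bar>h z - h x\<bar> < e / 2" if "z \<in> U" "z \<in> X" for z
    proof -
      have "h z \<in> ball (h x) (e / 2)" using U(2) that by blast
      then show ?thesis by (simp add: dist_real_def abs_minus_commute)
    qed
    ultimately show ?thesis by blast
  qed
  then obtain m where m: "\<And>x z. x \<in> X \<Longrightarrow> z \<in> X \<Longrightarrow> (\<forall>i<m x. z i = x i) \<Longrightarrow> \<bar>h z - h x\<bar> < e / 2"
    by metis
  define V where "V x = {z::nat \<Rightarrow> nat. \<forall>i<m x. z i = x i}" for x
  \<comment> \<open>\<open>V x\<close> fixes finitely many coordinates, each to a singleton, and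
    singletons of \<open>nat\<close> are open.\<close>
  have "open (V x)" for x
    using product_topology_basis'[of "{..<m x}" "\<lambda>i. {x i}" "\<lambda>i. i"]
    by (simp add: V_def Ball_def open_discrete)
  moreover have "X \<subseteq> (\<Union>x\<in>X. V x)" by (auto simp: V_def)
  ultimately obtain F where F: "F \<subseteq> X" "finite F" "X \<subseteq> (\<Union>x\<in>F. V x)"
    using compactE_image[OF compact_subshift[OF assms(1)], of X V] by blast
  show thesis
  proof
    fix x y :: "nat \<Rightarrow> nat"
    \<comment> \<open>\<open>F\<close> can be empty only if \<open>X\<close> is, and then the
      unspecified value of \<open>Max\<close> does no harm because there is no point
      \<open>x\<close>.\<close>
    assume xy: "x \<in> X" "y \<in> X" "\<And>i. i < Max (m ` F) \<Longrightarrow> x i = y i"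
    obtain c where c: "c \<in> F" "x \<in> V c" using F xy by blast
    then have "m c \<le> Max (m ` F)" using F by simp
    then have "y \<in> V c" using c xy by (auto simp: V_def)
    have "\<bar>h x - h c\<bar> < e / 2" "\<bar>h y - h c\<bar> < e / 2"
      using c F(1) xy(1,2) \<open>y \<in> V c\<close> by (auto simp only: V_def mem_Collect_eq intro!: m)
    then show "\<bar>h x - h y\<bar> < e" by linarith
  qed
qed

text \<open>Let \<open>m\<close> be the prefix length that makes \<open>h\<close> vary by less than
  \<open>e / 2\<close>. For \<open>i < n - m\<close> the shifted points still agree on
  \<open>m\<close> coordinates, so these terms cost at most \<open>e / 2\<close> each; the last
  \<open>m\<close> terms cost a constant.\<close>

lemma birkhoff_sum_variation:
  assumes X: "subshift X" and h: "continuous_on X h" and "e > 0"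
  shows "\<forall>\<^sub>F n in sequentially. \<forall>x\<in>X. \<forall>y\<in>X. (\<forall>i<n. x i = y i) \<longrightarrow>
           \<bar>birkhoff_sum h n x - birkhoff_sum h n y\<bar> \<le> e * real n"
proof -
  obtain m where m: "\<And>x y. x \<in> X \<Longrightarrow> y \<in> X \<Longrightarrow> (\<And>i. i < m \<Longrightarrow> x i = y i) \<Longrightarrow> \<bar>h x - h y\<bar> < e / 2"
    using subshift_uniformly_continuous[OF X h, of "e / 2"] \<open>e > 0\<close> by auto
  obtain B where B: "B > 0" "\<And>x. x \<in> X \<Longrightarrow> \<bar>h x\<bar> \<le> B"
    using continuous_on_subshift_bounded[OF X h] by blast
  \<comment> \<open>The second condition says exactly that the boundary cost
    \<open>2 * (real m * B)\<close> is at most \<open>real n * (e / 2)\<close>.\<close>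
  have "\<forall>\<^sub>F n in sequentially. n \<ge> m \<and> real n \<ge> 2 * (2 * B * real m) / e"
    by (intro eventually_conj eventually_ge_at_top eventually_ge_at_top[THEN
          filterlim_real_sequentially[unfolded filterlim_iff, rule_format]])
  then show ?thesis
  proof eventually_elim
    case (elim n)
    show ?case
    proof (intro ballI impI)
      fix x y assume xy: "x \<in> X" "y \<in> X" "\<forall>i<n. x i = y i"
      define r where "r = n - m"
      have n: "n = r + m" using elim by (simp add: r_def)
      have "\<bar>birkhoff_sum h r x - birkhoff_sum h r y\<bar>
          \<le> (\<Sum>i<r. \<bar>h ((left_shift ^^ i) x) - h ((left_shift ^^ i) y)\<bar>)"
        unfolding birkhoff_sum_def sum_subtractf[symmetric] by (rule sum_abs)
      also have "\<dots> \<le> (\<Sum>i<r. e / 2)"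
        using xy n
        by (intro sum_mono less_imp_le[OF m] subshift_funpow_mem[OF X])
           (auto simp: funpow_left_shift)
      finally have "\<bar>birkhoff_sum h r x - birkhoff_sum h r y\<bar> \<le> real r * (e / 2)"
        by simp
      moreover have "real r * (e / 2) \<le> real n * (e / 2)"
        using \<open>e > 0\<close> n by (intro mult_right_mono) auto
      moreover have "\<bar>birkhoff_sum h m ((left_shift ^^ r) z)\<bar> \<le> real m * B" if "z \<in> X" for z
        by (intro abs_birkhoff_sum_le[OF X] B subshift_funpow_mem[OF X that])
      from this[OF xy(1)] this[OF xy(2)]
      have "\<bar>birkhoff_sum h m ((left_shift ^^ r) x) - birkhoff_sum h m ((left_shift ^^ r) y)\<bar>
          \<le> 2 * (real m * B)"
        by linarith
      moreover have "2 * (real m * B) \<le> real n * (e / 2)"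
        using elim \<open>e > 0\<close> by (simp add: field_simps)
      moreover have
        "birkhoff_sum h n x = birkhoff_sum h r x + birkhoff_sum h m ((left_shift ^^ r) x)"
        "birkhoff_sum h n y = birkhoff_sum h r y + birkhoff_sum h m ((left_shift ^^ r) y)"
        unfolding n by (rule birkhoff_sum_add)+
      moreover have "real n * (e / 2) + real n * (e / 2) = e * real n"
        by simp
      ultimately show "\<bar>birkhoff_sum h n x - birkhoff_sum h n y\<bar> \<le> e * real n"
        by linarith
    qed
  qed
qed

section \<open>Tempered variation and subadditivity in logarithmic form\<close>

lemma log_sequence_pos: "log_sequence_on X f \<Longrightarrow> n \<ge> 1 \<Longrightarrow> x \<in> X \<Longrightarrow> f n x > 0"
  by (simp add: log_sequence_on_def)

lemma continuous_on_ln_log_sequence: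
  assumes "log_sequence_on X f" "n \<ge> 1"
  shows "continuous_on X (\<lambda>x. ln (f n x))"
proof (rule continuous_on_ln)
  show "continuous_on X (f n)" using assms by (simp add: log_sequence_on_def)
  show "\<forall>x\<in>X. f n x \<noteq> 0" using log_sequence_pos[OF assms] by force
qed

lemma ln_div_exp_birkhoff_sum:
  assumes "log_sequence_on X f" "n \<ge> 1" "x \<in> X"
  shows "ln (f n x / exp (birkhoff_sum h n x)) = ln (f n x) - birkhoff_sum h n x"
  using log_sequence_pos[OF assms] by (simp add: ln_div)

text \<open>The real \<open>Sup\<close> dominates the ratios only if their set is bounded above;
  this comes from the boundedness of \<open>ln (f n)\<close> on the compact
  \<open>X\<close>.\<close>

lemma tempered_variation_eventually:
  assumes X: "subshift X" and f: "log_sequence_on X f" and temp: "tempered_variation_on X f"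
    and "e > 0"
  shows "\<forall>\<^sub>F n in sequentially. \<forall>x\<in>X. \<forall>y\<in>X. (\<forall>i<n. x i = y i) \<longrightarrow>
           ln (f n x) - ln (f n y) \<le> e * real n"
proof -
  define V where "V n = {f n x / f n y | x y. x \<in> X \<and> y \<in> X \<and> (\<forall>i<n. x i = y i)}" for n
  have "\<forall>\<^sub>F n in sequentially. dist (1 / real n * ln (Sup (V n))) 0 < e"
    using temp \<open>e > 0\<close> unfolding tempered_variation_on_def V_def by (rule tendstoD)
  then show ?thesis
    using eventually_gt_at_top[of 0]
  proof eventually_elim
    case (elim n)
    have pos: "f n x > 0" if "x \<in> X" for x
      using f elim that by (auto simp: log_sequence_on_def)
    have cont: "continuous_on X (\<lambda>x. ln (f n x))"
      using elim by (intro continuous_on_ln_log_sequence[OF f]) simp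
    obtain B where B: "\<And>x. x \<in> X \<Longrightarrow> \<bar>ln (f n x)\<bar> \<le> B"
      using continuous_on_subshift_bounded[OF X cont] by blast
    have bdd: "bdd_above (V n)"
    proof (rule bdd_aboveI)
      fix v assume "v \<in> V n"
      then obtain x y where xy: "x \<in> X" "y \<in> X" "v = f n x / f n y"
        by (auto simp: V_def)
      have "ln v \<le> 2 * B"
        using B[OF xy(1)] B[OF xy(2)] pos[OF xy(1)] pos[OF xy(2)] xy(3) by (simp add: ln_div)
      then show "v \<le> exp (2 * B)"
        using pos xy by (metis divide_pos_pos exp_le_cancel_iff exp_ln)
    qed
    show ?case
    proof (intro ballI impI)
      fix x y assume xy: "x \<in> X" "y \<in> X" "\<forall>i<n. x i = y i"
      have "f n x / f n y \<le> Sup (V n)"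
        using xy by (intro cSup_upper[OF _ bdd]) (auto simp: V_def)
      then have "ln (f n x / f n y) \<le> ln (Sup (V n))"
        using pos xy by (intro ln_mono) (auto intro: order_less_le_trans[rotated])
      moreover have "ln (Sup (V n)) \<le> e * real n"
        using elim by (simp add: field_simps)
      ultimately show "ln (f n x) - ln (f n y) \<le> e * real n"
        using pos[OF xy(1)] pos[OF xy(2)] by (simp add: ln_div)
    qed
  qed
qed

text \<open>One of the two factors \<open>exp C\<close> on the right cancels against the left, so
  each splitting costs a single additive \<open>C\<close>.\<close>

lemma ln_subadditive:
  assumes "subshift X" "log_sequence_on X f" "subadditive_on X (\<lambda>n x. exp C * f n x)"
    and "n \<ge> 1" "m \<ge> 1" "x \<in> X"
  shows "ln (f (n + m) x) \<le> C + ln (f n x) + ln (f m ((left_shift ^^ n) x))"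
proof -
  let ?y = "(left_shift ^^ n) x"
  have "?y \<in> X" using assms subshift_funpow_mem by blast
  then have pos: "f (n + m) x > 0" "f n x > 0" "f m ?y > 0"
    using assms by (auto simp: log_sequence_on_def)
  have "exp C * f (n + m) x \<le> (exp C * f n x) * (exp C * f m ?y)"
    using assms unfolding subadditive_on_def by blast
  then have "f (n + m) x \<le> f n x * (exp C * f m ?y)"
    by (simp add: mult.assoc)
  then have "ln (f (n + m) x) \<le> ln (f n x * (exp C * f m ?y))"
    using pos by simp
  then show ?thesis
    using pos by (simp add: ln_mult)
qed

text \<open>Cutting \<open>j\<close> blocks of length \<open>p\<close> takes \<open>j - 1\<close>
  splittings, and each block starts at \<open>z\<close> again.\<close>

lemma ln_subadditive_periodic:
  assumes "subshift X" "log_sequence_on X f" "subadditive_on X (\<lambda>n x. exp C * f n x)"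
    and "p \<ge> 1" "z \<in> X" "(left_shift ^^ p) z = z" "j \<ge> 1"
  shows "ln (f (j * p) z) \<le> real j * (C + ln (f p z)) - C"
  using \<open>j \<ge> 1\<close>
proof (induction j rule: dec_induct)
  case base
  then show ?case by simp
next
  case (step j)
  have "ln (f (p + j * p) z) \<le> C + ln (f p z) + ln (f (j * p) ((left_shift ^^ p) z))"
    using assms step by (intro ln_subadditive) auto
  then show ?case
    using step.IH assms(6) by (simp add: algebra_simps)
qed

section \<open>From limits at periodic points to a uniform estimate\<close>

text \<open>The limit is sampled along the multiples of \<open>p\<close>, where the Birkhoff sum is
  exactly \<open>j\<close> times the sum over one period.\<close>

lemma periodic_limit:
  assumes f: "log_sequence_on X f" and "p \<ge> 1" "z \<in> X" "(left_shift ^^ p) z = z"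
    and lim: "(\<lambda>n. 1 / real n * ln (f n z / exp (birkhoff_sum h n z))) \<longlonglongrightarrow> 0"
  shows "(\<lambda>j. ln (f (j * p) z) / real j) \<longlonglongrightarrow> birkhoff_sum h p z"
proof -
  have "filterlim (\<lambda>j. j * p) sequentially sequentially"
    using \<open>p \<ge> 1\<close> by (intro filterlim_subseq strict_monoI) auto
  from filterlim_compose[OF lim this]
  have "(\<lambda>j. real p * (1 / real (j * p) * ln (f (j * p) z / exp (birkhoff_sum h (j * p) z)))
          + birkhoff_sum h p z) \<longlonglongrightarrow> real p * 0 + birkhoff_sum h p z"
    by (intro tendsto_intros)
  moreover have "\<forall>\<^sub>F j in sequentially.
      real p * (1 / real (j * p) * ln (f (j * p) z / exp (birkhoff_sum h (j * p) z)))
        + birkhoff_sum h p z = ln (f (j * p) z) / real j"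
    using eventually_gt_at_top[of 0]
  proof eventually_elim
    case (elim j)
    then have "j * p \<ge> 1" using \<open>p \<ge> 1\<close> by simp
    then show ?case
      using elim \<open>p \<ge> 1\<close>
      unfolding ln_div_exp_birkhoff_sum[OF f \<open>j * p \<ge> 1\<close> \<open>z \<in> X\<close>]
      unfolding birkhoff_sum_periodic[OF assms(4)]
      by (simp add: field_simps)
  qed
  ultimately show ?thesis
    by (simp add: tendsto_cong)
qed

lemma repeat_word_periodic: "(left_shift ^^ length u) (repeat_word u) = repeat_word u"
  by (simp add: funpow_left_shift repeat_word_def)

lemma repeat_word_append_nth: "i < length u \<Longrightarrow> repeat_word (u @ w) i = u ! i"
  by (simp add: repeat_word_def nth_append)

lemma length_words: "u \<in> words X n \<Longrightarrow> length u = n"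
  by (auto simp: words_def split: if_splits)

lemma initial_word:
  assumes "x \<in> X"
  shows "map x [0..<n] \<in> words X n"
proof (cases "n = 0")
  case False
  then show ?thesis
    unfolding words_def using assms by (auto intro!: exI[of _ x] exI[of _ "0::nat"])
qed (simp add: words_def)

text \<open>The error is counted in units of \<open>e / 4 * real n\<close>: one for the variation of
  the Birkhoff sums, one for \<open>K\<close>, and one for \<open>M n\<close> (upper bound on
  \<open>ln (f n x)\<close>) or for the variation of \<open>f n\<close> (lower bound).\<close>

lemma periodic_limits_imp_uniform:
  fixes h :: "(nat \<Rightarrow> nat) \<Rightarrow> real"
  assumes X: "subshift X" and f: "log_sequence_on X f" and temp: "tempered_variation_on X f"
    and "C \<ge> 0" and sub: "subadditive_on X (\<lambda>n x. exp C * f n x)"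
    and Mpos: "\<And>n. n \<ge> 1 \<Longrightarrow> M n > 0"
    and M: "(\<lambda>n. 1 / real n * ln (M n)) \<longlonglongrightarrow> 0"
    and spec: "\<And>n u. n \<ge> N \<Longrightarrow> u \<in> words X n \<Longrightarrow>
           \<exists>q\<le>k. \<exists>w\<in>words X q. repeat_word (u @ w) \<in> X \<and>
             (\<forall>j\<ge>1. f (j * (n + q)) (repeat_word (u @ w))
                       \<ge> (M n * (SUP x\<in>cylinder X u. f n x)) ^ j)"
    and h: "continuous_on X h"
    and per: "\<And>x. x \<in> X \<Longrightarrow> periodic_point x \<Longrightarrow>
             (\<lambda>n. 1 / real n * ln (f n x / exp (birkhoff_sum h n x))) \<longlonglongrightarrow> 0"
    and "e > 0"
  shows "\<forall>\<^sub>F n in sequentially. \<forall>x\<in>X. \<bar>ln (f n x) - birkhoff_sum h n x\<bar> \<le> e * real n"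
proof -
  obtain B where B: "B > 0" "\<And>x. x \<in> X \<Longrightarrow> \<bar>h x\<bar> \<le> B"
    using continuous_on_subshift_bounded[OF X h] by blast
  \<comment> \<open>These bounds will absorb the factor of \<open>f\<close> that belongs to the
    connecting word. Being nonnegative, each is at most their sum over \<open>1..k\<close>.\<close>
  have "\<exists>D\<ge>0. \<forall>x\<in>X. ln (f q x) \<le> D" if "q \<ge> 1" for q
    using continuous_on_subshift_bounded[OF X continuous_on_ln_log_sequence[OF f that]]
    by (metis abs_le_D1 less_imp_le)
  then obtain D where D: "\<And>q. q \<ge> 1 \<Longrightarrow> D q \<ge> 0"
      "\<And>q x. q \<ge> 1 \<Longrightarrow> x \<in> X \<Longrightarrow> ln (f q x) \<le> D q"
    by metis
  \<comment> \<open>\<open>K\<close> collects all errors independent of \<open>n\<close>: two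
    splittings, \<open>ln (f q)\<close> along the connecting word, and the Birkhoff sum of at most
    \<open>k\<close> terms along it.\<close>
  define K where "K = 2 * C + (\<Sum>q=1..k. D q) + real k * B"
  have Dle: "D q \<le> (\<Sum>q=1..k. D q)" if "1 \<le> q" "q \<le> k" for q
    using that D(1) by (intro member_le_sum) auto
  have D0: "(\<Sum>q=1..k. D q) \<ge> 0"
    using D(1) by (intro sum_nonneg) auto
  have e4: "e / 4 > 0" using \<open>e > 0\<close> by simp
  have "\<forall>\<^sub>F n in sequentially. dist (1 / real n * ln (M n)) 0 < e / 4"
    by (rule tendstoD[OF M e4])
  moreover have "\<forall>\<^sub>F n in sequentially. real n \<ge> 4 * K / e"
    by (intro eventually_ge_at_top[THEN
          filterlim_real_sequentially[unfolded filterlim_iff, rule_format]])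
  ultimately show ?thesis
    using tempered_variation_eventually[OF X f temp e4] birkhoff_sum_variation[OF X h e4]
      eventually_ge_at_top[of N] eventually_ge_at_top[of 1]
  proof eventually_elim
    case (elim n)
    note var_f = elim(3)[rule_format] and var_h = elim(4)[rule_format]
    have Mn: "- ln (M n) \<le> e / 4 * real n"
    proof -
      have "\<bar>ln (M n)\<bar> \<le> e / 4 * real n" using elim(1,6) by (simp add: field_simps)
      then show ?thesis by linarith
    qed
    have Kn: "K \<le> e / 4 * real n"
      using elim(2) \<open>e > 0\<close> by (simp add: field_simps)
    show ?case
    proof
      fix x assume x: "x \<in> X"
      define u where "u = map x [0..<n]"
      have u: "u \<in> words X n" "length u = n"
        using initial_word[OF x] by (auto simp: u_def)
      from spec[OF elim(5) u(1)] obtain q w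
        where "q \<le> k" and w: "w \<in> words X q" and zX: "repeat_word (u @ w) \<in> X"
          and low: "\<And>j. j \<ge> 1 \<Longrightarrow> (M n * (SUP x\<in>cylinder X u. f n x)) ^ j
                      \<le> f (j * (n + q)) (repeat_word (u @ w))"
        by blast
      define z where "z = repeat_word (u @ w)"
      define p where "p = n + q"
      define s where "s = (SUP x\<in>cylinder X u. f n x)"
      have z: "z \<in> X" using zX by (simp add: z_def)
      have "length w = q" using w by (rule length_words)
      have "p \<ge> 1" using elim(6) by (simp add: p_def)
      have pz: "(left_shift ^^ p) z = z"
        using repeat_word_periodic[of "u @ w"] u \<open>length w = q\<close> by (simp add: p_def z_def)
      have zx: "\<forall>i<n. z i = x i"
        using u(2) by (auto simp: z_def repeat_word_append_nth u_def)
      have lim: "(\<lambda>j. ln (f (j * p) z) / real j) \<longlonglongrightarrow> birkhoff_sum h p z"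
        using pz \<open>p \<ge> 1\<close>
        by (intro periodic_limit[OF f \<open>p \<ge> 1\<close> z pz] per z) (auto simp: periodic_point_def)
      have split: "\<bar>birkhoff_sum h p z - birkhoff_sum h n z\<bar> \<le> real k * B"
      proof -
        have "\<bar>birkhoff_sum h q ((left_shift ^^ n) z)\<bar> \<le> real q * B"
          using B by (intro abs_birkhoff_sum_le[OF X] subshift_funpow_mem[OF X z])
        also have "\<dots> \<le> real k * B"
          using \<open>q \<le> k\<close> B by (intro mult_right_mono) auto
        finally show ?thesis by (simp add: p_def birkhoff_sum_add)
      qed
      have hzx: "\<bar>birkhoff_sum h n z - birkhoff_sum h n x\<bar> \<le> e / 4 * real n"
        using var_h[OF z x] zx by simp
      have fx: "f n x > 0" using f x elim(6) by (auto simp: log_sequence_on_def)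
      have "f n x \<le> s"
        unfolding s_def
      proof (rule cSUP_upper)
        show "x \<in> cylinder X u" using x by (auto simp: cylinder_def u_def)
        obtain b where "\<And>y. y \<in> X \<Longrightarrow> \<bar>f n y\<bar> \<le> b"
          using continuous_on_subshift_bounded[OF X] f elim(6)
          unfolding log_sequence_on_def by metis
        then show "bdd_above (f n ` cylinder X u)"
          by (intro bdd_aboveI2[of _ _ b]) (auto simp: cylinder_def abs_le_iff)
      qed
      with fx have "s > 0" by simp
      have "M n > 0" using Mpos elim(6) by simp
      \<comment> \<open>After taking logarithms the exponent \<open>j\<close> cancels against the
        division by \<open>j\<close>, so the left side is constant and survives the limit.\<close>
      have "ln (M n) + ln s \<le> birkhoff_sum h p z"
      proof (rule tendsto_lowerbound[OF lim])
        show "\<forall>\<^sub>F j in sequentially. ln (M n) + ln s \<le> ln (f (j * p) z) / real j"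
          using eventually_ge_at_top[of 1]
        proof eventually_elim
          case (elim j)
          have "ln ((M n * s) ^ j) \<le> ln (f (j * p) z)"
            using low[OF elim] \<open>M n > 0\<close> \<open>s > 0\<close>
            unfolding z_def[symmetric] p_def[symmetric] s_def[symmetric]
            by (intro ln_mono) auto
          then show ?case
            using \<open>M n > 0\<close> \<open>s > 0\<close> elim by (simp add: ln_realpow ln_mult field_simps)
        qed
      qed simp
      moreover have "ln (f n x) \<le> ln s"
        using \<open>f n x \<le> s\<close> fx by simp
      ultimately have "ln (f n x) - birkhoff_sum h n x \<le> 3 * (e / 4 * real n)"
        using split hzx Mn Kn D0 \<open>C \<ge> 0\<close> unfolding K_def by linarith
      \<comment> \<open>The opposite direction: subadditivity bounds the same quotients from above,
        uniformly in \<open>j\<close>.\<close>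
      have "birkhoff_sum h p z \<le> C + ln (f p z)"
      proof (rule tendsto_upperbound[OF lim])
        show "\<forall>\<^sub>F j in sequentially. ln (f (j * p) z) / real j \<le> C + ln (f p z)"
          using eventually_ge_at_top[of 1]
        proof eventually_elim
          case (elim j)
          then show ?case
            using ln_subadditive_periodic[OF X f sub \<open>p \<ge> 1\<close> z pz elim] \<open>C \<ge> 0\<close>
            by (simp add: field_simps)
        qed
      qed simp
      moreover have "ln (f p z) \<le> C + ln (f n z) + (\<Sum>q=1..k. D q)"
      \<comment> \<open>Subadditivity speaks of indices from 1 on and \<open>f 0\<close> is
        unconstrained, so the empty connecting word is treated separately.\<close>
      proof (cases "q = 0")
        case True
        then show ?thesis using D0 \<open>C \<ge> 0\<close> by (simp add: p_def)
      next
        case False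
        then have "ln (f p z) \<le> C + ln (f n z) + ln (f q ((left_shift ^^ n) z))"
          unfolding p_def using elim(6) by (intro ln_subadditive[OF X f sub _ _ z]) auto
        moreover have "ln (f q ((left_shift ^^ n) z)) \<le> D q"
          using False by (intro D(2) subshift_funpow_mem[OF X z]) auto
        ultimately show ?thesis using Dle[of q] False \<open>q \<le> k\<close> by linarith
      qed
      moreover have "ln (f n z) - ln (f n x) \<le> e / 4 * real n"
        using var_f[OF z x] zx by simp
      ultimately have "birkhoff_sum h n x - ln (f n x) \<le> 3 * (e / 4 * real n)"
        using split hzx Kn unfolding K_def by linarith
      with \<open>ln (f n x) - birkhoff_sum h n x \<le> 3 * (e / 4 * real n)\<close>
      have "\<bar>ln (f n x) - birkhoff_sum h n x\<bar> \<le> 3 * (e / 4 * real n)" by linarith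
      also have "\<dots> \<le> e * real n" using \<open>e > 0\<close> by simp
      finally show "\<bar>ln (f n x) - birkhoff_sum h n x\<bar> \<le> e * real n" .
    qed
  qed
qed

section \<open>Integration against invariant measures\<close>

lemma space_invariant_measure: "\<mu> \<in> invariant_measures X \<Longrightarrow> space \<mu> = X"
  by (auto simp: invariant_measures_def space_restrict_space dest!: sets_eq_imp_space_eq)

lemma borel_measurable_invariant_measure:
  fixes g :: "(nat \<Rightarrow> nat) \<Rightarrow> real"
  assumes "\<mu> \<in> invariant_measures X" "continuous_on X g"
  shows "g \<in> borel_measurable \<mu>"
proof -
  have "sets \<mu> = sets (restrict_space borel X)"
    using assms by (simp add: invariant_measures_def)
  then show ?thesis
    using borel_measurable_continuous_on_restrict[OF assms(2)] measurable_cong_sets by blast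
qed

lemma integrable_invariant_measure:
  fixes g :: "(nat \<Rightarrow> nat) \<Rightarrow> real"
  assumes X: "subshift X" and \<mu>: "\<mu> \<in> invariant_measures X" and g: "continuous_on X g"
  shows "integrable \<mu> g"
proof -
  interpret prob_space \<mu> using \<mu> by (simp add: invariant_measures_def)
  obtain B where "\<And>x. x \<in> X \<Longrightarrow> \<bar>g x\<bar> \<le> B"
    using continuous_on_subshift_bounded[OF X g] by blast
  then show ?thesis
    using borel_measurable_invariant_measure[OF \<mu> g] space_invariant_measure[OF \<mu>]
    by (intro integrable_const_bound[of _ B]) (auto intro!: AE_I2)
qed

lemma measurable_left_shift:
  assumes "subshift X"
  shows "left_shift \<in> measurable (restrict_space borel X) (restrict_space borel X)"
  using assms continuous_on_funpow_left_shift[of X 1]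
  by (intro measurable_restrict_space2 borel_measurable_continuous_on_restrict)
     (auto simp: space_restrict_space subshift_def)

text \<open>Invariance as an equality of measures, the form that the change of variables in
  integrals uses.\<close>

lemma distr_left_shift:
  assumes X: "subshift X" and \<mu>: "\<mu> \<in> invariant_measures X"
  shows "left_shift \<in> measurable \<mu> \<mu>" "distr \<mu> \<mu> left_shift = \<mu>"
proof -
  have sets: "sets \<mu> = sets (restrict_space borel X)"
    using \<mu> by (simp add: invariant_measures_def)
  show meas: "left_shift \<in> measurable \<mu> \<mu>"
    using measurable_left_shift[OF X] measurable_cong_sets[OF sets sets] by blast
  show "distr \<mu> \<mu> left_shift = \<mu>"
    using \<mu> by (intro measure_eqI) (auto simp: emeasure_distr[OF meas] invariant_measures_def)
qed

lemma integral_comp_funpow_left_shift: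
  fixes g :: "(nat \<Rightarrow> nat) \<Rightarrow> real"
  assumes X: "subshift X" and \<mu>: "\<mu> \<in> invariant_measures X" and g: "continuous_on X g"
  shows "(\<integral>x. g ((left_shift ^^ i) x) \<partial>\<mu>) = (\<integral>x. g x \<partial>\<mu>)"
proof (induction i)
  case (Suc i)
  have "(\<integral>x. g ((left_shift ^^ i) x) \<partial>\<mu>) = (\<integral>x. g ((left_shift ^^ i) x) \<partial>distr \<mu> \<mu> left_shift)"
    by (simp only: distr_left_shift(2)[OF X \<mu>])
  also have "\<dots> = (\<integral>x. g ((left_shift ^^ i) (left_shift x)) \<partial>\<mu>)"
    by (intro integral_distr distr_left_shift[OF X \<mu>] borel_measurable_invariant_measure[OF \<mu>]
          continuous_on_comp_funpow[OF X g])
  finally show ?case using Suc by (simp add: funpow_swap1)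
qed simp

lemma integral_birkhoff_sum:
  assumes X: "subshift X" and \<mu>: "\<mu> \<in> invariant_measures X" and h: "continuous_on X h"
  shows "(\<integral>x. birkhoff_sum h n x \<partial>\<mu>) = real n * (\<integral>x. h x \<partial>\<mu>)"
proof -
  have "(\<integral>x. birkhoff_sum h n x \<partial>\<mu>) = (\<Sum>i<n. \<integral>x. h ((left_shift ^^ i) x) \<partial>\<mu>)"
    unfolding birkhoff_sum_def
    by (intro Bochner_Integration.integral_sum integrable_invariant_measure[OF X \<mu>]
          continuous_on_comp_funpow[OF X h])
  then show ?thesis by (simp add: integral_comp_funpow_left_shift[OF X \<mu> h])
qed

text \<open>By invariance the Birkhoff sum integrates to \<open>n\<close> times the integral of
  \<open>h\<close>, and a uniform error bound is preserved by integration against a probability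
  measure.\<close>

lemma uniform_imp_integral_limit:
  assumes X: "subshift X" and f: "log_sequence_on X f" and h: "continuous_on X h"
    and \<mu>: "\<mu> \<in> invariant_measures X"
    and unif: "\<And>e. e > 0 \<Longrightarrow>
      \<forall>\<^sub>F n in sequentially. \<forall>x\<in>X. \<bar>ln (f n x) - birkhoff_sum h n x\<bar> \<le> e * real n"
  shows "(\<lambda>n. 1 / real n * (\<integral>x. ln (f n x) \<partial>\<mu>)) \<longlonglongrightarrow> (\<integral>x. h x \<partial>\<mu>)"
proof (rule tendstoI)
  interpret prob_space \<mu> using \<mu> by (simp add: invariant_measures_def)
  fix e :: real assume "e > 0"
  then have "e / 2 > 0" by simp
  from unif[OF this] eventually_gt_at_top[of 0]
  show "\<forall>\<^sub>F n in sequentially. dist (1 / real n * (\<integral>x. ln (f n x) \<partial>\<mu>)) (\<integral>x. h x \<partial>\<mu>) < e"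
  proof eventually_elim
    case (elim n)
    have int_f: "integrable \<mu> (\<lambda>x. ln (f n x))"
      using elim
      by (intro integrable_invariant_measure[OF X \<mu>] continuous_on_ln_log_sequence[OF f]) simp
    have int_h: "integrable \<mu> (birkhoff_sum h n)"
      by (intro integrable_invariant_measure[OF X \<mu>] continuous_on_birkhoff_sum[OF X h])
    have "\<bar>(\<integral>x. ln (f n x) \<partial>\<mu>) - real n * (\<integral>x. h x \<partial>\<mu>)\<bar>
        = \<bar>\<integral>x. ln (f n x) - birkhoff_sum h n x \<partial>\<mu>\<bar>"
      using int_f int_h by (simp add: integral_birkhoff_sum[OF X \<mu> h])
    also have "\<dots> \<le> (\<integral>x. \<bar>ln (f n x) - birkhoff_sum h n x\<bar> \<partial>\<mu>)"
      by (rule integral_abs_bound)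
    also have "\<dots> \<le> e / 2 * real n"
      using elim int_f int_h space_invariant_measure[OF \<mu>]
      by (intro integral_le_const) (auto intro!: AE_I2)
    also have "\<dots> < e * real n"
      using \<open>e > 0\<close> elim by simp
    finally have "\<bar>(\<integral>x. ln (f n x) \<partial>\<mu>) - real n * (\<integral>x. h x \<partial>\<mu>)\<bar> / real n < e"
      using elim by (simp add: field_simps)
    moreover have "1 / real n * (\<integral>x. ln (f n x) \<partial>\<mu>) - (\<integral>x. h x \<partial>\<mu>)
        = ((\<integral>x. ln (f n x) \<partial>\<mu>) - real n * (\<integral>x. h x \<partial>\<mu>)) / real n"
      using elim by (simp add: field_simps)
    ultimately show ?case
      by (simp add: dist_real_def abs_divide)
  qed
qed

section \<open>Measures on periodic orbits\<close>

text \<open>The uniform distribution is put on the times \<open>0, ..., p - 1\<close> and not on the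
  set of orbit points, so \<open>p\<close> may be any period of \<open>x\<close>, minimal or
  not.\<close>

definition orbit_measure :: "(nat \<Rightarrow> nat) set \<Rightarrow> nat \<Rightarrow> (nat \<Rightarrow> nat) \<Rightarrow> (nat \<Rightarrow> nat) measure" where
  "orbit_measure X p x =
     distr (measure_pmf (pmf_of_set {..<p})) (restrict_space borel X) (\<lambda>i. (left_shift ^^ i) x)"

lemma measurable_orbit:
  assumes "subshift X" "x \<in> X"
  shows "(\<lambda>i. (left_shift ^^ i) x) \<in> measurable (measure_pmf P) (restrict_space borel X)"
  using subshift_funpow_mem[OF assms] by (auto simp: measurable_def space_restrict_space)

lemma integral_orbit_measure:
  fixes g :: "(nat \<Rightarrow> nat) \<Rightarrow> real"
  assumes "subshift X" "x \<in> X" "p \<ge> 1" "continuous_on X g"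
  shows "(\<integral>y. g y \<partial>orbit_measure X p x) = birkhoff_sum g p x / real p"
proof -
  have "{..<p} \<noteq> {}" using assms by (auto simp: lessThan_empty_iff)
  then show ?thesis
    unfolding orbit_measure_def birkhoff_sum_def
    by (simp add: integral_distr[OF measurable_orbit[OF assms(1,2)]
          borel_measurable_continuous_on_restrict[OF assms(4)]] integral_pmf_of_set)
qed

text \<open>Taking the preimage under the shift advances every time by one, and the range of times
  closes up because time \<open>p\<close> is time 0.\<close>

lemma orbit_measure_invariant:
  assumes X: "subshift X" and x: "x \<in> X" and "p \<ge> 1" and per: "(left_shift ^^ p) x = x"
  shows "orbit_measure X p x \<in> invariant_measures X"
proof -
  note meas = measurable_orbit[OF X x]
  let ?\<mu> = "orbit_measure X p x"
  have sets: "sets ?\<mu> = sets (restrict_space borel X)"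
    and space: "space ?\<mu> = X"
    by (simp_all add: orbit_measure_def space_restrict_space)
  have ne: "{..<p} \<noteq> {}" using \<open>p \<ge> 1\<close> by (auto simp: lessThan_empty_iff)
  have em: "emeasure ?\<mu> A = ennreal ((\<Sum>i<p. of_bool ((left_shift ^^ i) x \<in> A)) / real p)"
    if "A \<in> sets (restrict_space borel X)" for A
  proof -
    have "card ({..<p} \<inter> (\<lambda>i. (left_shift ^^ i) x) -` A)
        = (\<Sum>i<p. of_bool ((left_shift ^^ i) x \<in> A))"
      by (simp add: sum_of_bool_eq vimage_def Int_def)
    then show ?thesis
      using that ne by (simp add: orbit_measure_def emeasure_distr[OF meas] emeasure_pmf_of_set)
  qed
  have "emeasure ?\<mu> (left_shift -` A \<inter> space ?\<mu>) = emeasure ?\<mu> A"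
    if A: "A \<in> sets (restrict_space borel X)" for A
  proof -
    have "left_shift -` A \<inter> X \<in> sets (restrict_space borel X)"
      using measurable_sets[OF measurable_left_shift[OF X] A] by (simp add: space_restrict_space)
    moreover have "(\<Sum>i<p. of_bool ((left_shift ^^ i) x \<in> left_shift -` A \<inter> X) :: real)
        = (\<Sum>i<p. of_bool ((left_shift ^^ Suc i) x \<in> A))"
      using subshift_funpow_mem[OF X x] by (intro sum.cong) auto
    \<comment> \<open>The sum over \<open>i < Suc p\<close> is peeled once at the end and once at
      the start; the two removed terms agree by \<open>per\<close>.\<close>
    moreover have "\<dots> = (\<Sum>i<p. of_bool ((left_shift ^^ i) x \<in> A))"
      using sum.lessThan_Suc[of "\<lambda>i. of_bool ((left_shift ^^ i) x \<in> A) :: real" p]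
        sum.lessThan_Suc_shift[of "\<lambda>i. of_bool ((left_shift ^^ i) x \<in> A) :: real" p] per
      by simp
    ultimately show ?thesis
      by (simp add: em A space)
  qed
  moreover have "prob_space ?\<mu>"
    unfolding orbit_measure_def by (intro measure_pmf.prob_space_distr meas)
  ultimately show ?thesis
    by (simp add: invariant_measures_def sets)
qed

text \<open>
  Up to an additive constant, \<open>ln (f (n + p))\<close> averaged over the orbit lies below \<open>ln (f n x)\<close>,
  which in turn lies below the average of \<open>ln (f (n - p))\<close>.
\<close>

lemma integral_limit_imp_periodic_limit:
  fixes h :: "(nat \<Rightarrow> nat) \<Rightarrow> real"
  assumes X: "subshift X" and f: "log_sequence_on X f"
    and sub: "subadditive_on X (\<lambda>n x. exp C * f n x)"
    and h: "continuous_on X h" and x: "x \<in> X" and "p \<ge> 1" and per: "(left_shift ^^ p) x = x"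
    and lim: "(\<lambda>n. 1 / real n * (\<integral>y. ln (f n y) \<partial>orbit_measure X p x))
                \<longlonglongrightarrow> (\<integral>y. h y \<partial>orbit_measure X p x)"
  shows "(\<lambda>n. 1 / real n * ln (f n x / exp (birkhoff_sum h n x))) \<longlonglongrightarrow> 0"
proof -
  define L where "L = birkhoff_sum h p x / real p"
  define g where "g n = birkhoff_sum (\<lambda>y. ln (f n y)) p x / real p" for n
  have orb: "(left_shift ^^ i) x \<in> X" for i
    using subshift_funpow_mem[OF X x] .
  have "\<forall>\<^sub>F n in sequentially. 1 / real n * (\<integral>y. ln (f n y) \<partial>orbit_measure X p x) = g n / real n"
    using eventually_ge_at_top[of 1]
    by eventually_elim (simp add: integral_orbit_measure[OF X x \<open>p \<ge> 1\<close>] continuous_on_ln_log_sequence[OF f] g_def)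
  with lim have g: "(\<lambda>n. g n / real n) \<longlonglongrightarrow> L"
    unfolding integral_orbit_measure[OF X x \<open>p \<ge> 1\<close> h] L_def[symmetric]
    by (rule Lim_transform_eventually)
  \<comment> \<open>\<open>K\<close> bounds the cost of cutting off a piece of length at most
    \<open>p\<close> at any orbit point. Only finitely many values occur, and 0 is inserted to make
    \<open>K\<close> nonnegative.\<close>
  obtain K where K: "K \<ge> 0" "\<And>i j. i \<in> {1..p} \<Longrightarrow> j \<in> {..p} \<Longrightarrow> C + ln (f i ((left_shift ^^ j) x)) \<le> K"
  proof
    let ?S = "insert 0 ((\<lambda>(i,j). C + ln (f i ((left_shift ^^ j) x))) ` ({1..p} \<times> {..p}))"
    show "Max ?S \<ge> 0" by (intro Max_ge) auto
    show "C + ln (f i ((left_shift ^^ j) x)) \<le> Max ?S" if "i \<in> {1..p}" "j \<in> {..p}" for i j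
      using that by (intro Max_ge) auto
  qed
  \<comment> \<open>The window of length \<open>n + p\<close> at \<open>x\<close> contains the
    window of length \<open>n\<close> at each orbit point: cut off \<open>i\<close> symbols in front
    and \<open>p - i\<close> at the back, then average over \<open>i\<close>.\<close>
  have up: "ln (f (n + p) x) \<le> g n + 2 * K" if "n \<ge> 1" for n
  proof -
    have "ln (f (n + p) x) \<le> ln (f n ((left_shift ^^ i) x)) + 2 * K" if "i < p" for i
    proof -
      have first: "ln (f (n + p) x) \<le> ln (f (n + (p - i)) ((left_shift ^^ i) x)) + K"
      proof (cases "i = 0")
        case False
        have "ln (f (i + (n + (p - i))) x)
            \<le> C + ln (f i x) + ln (f (n + (p - i)) ((left_shift ^^ i) x))"
          using False \<open>n \<ge> 1\<close> by (intro ln_subadditive[OF X f sub _ _ x]) auto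
        moreover have "C + ln (f i x) \<le> K" using K(2)[of i 0] False \<open>i < p\<close> by simp
        ultimately show ?thesis using \<open>i < p\<close> by (simp add: add_ac)
      qed (use K in simp)
      have "ln (f (n + (p - i)) ((left_shift ^^ i) x))
          \<le> C + ln (f n ((left_shift ^^ i) x))
            + ln (f (p - i) ((left_shift ^^ n) ((left_shift ^^ i) x)))"
        using \<open>i < p\<close> \<open>n \<ge> 1\<close> by (intro ln_subadditive[OF X f sub _ _ orb]) auto
      \<comment> \<open>Reducing the time modulo \<open>p\<close> brings the starting point into the
        finite range covered by \<open>K\<close>.\<close>
      moreover have "(left_shift ^^ n) ((left_shift ^^ i) x) = (left_shift ^^ ((n + i) mod p)) x"
        by (simp only: funpow_mod_eq[OF per] funpow_add comp_apply)
      moreover have "C + ln (f (p - i) ((left_shift ^^ ((n + i) mod p)) x)) \<le> K"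
        using \<open>i < p\<close> by (intro K(2)) (auto simp: less_imp_le)
      ultimately show ?thesis using first by simp
    qed
    then have "(\<Sum>i<p. ln (f (n + p) x)) \<le> (\<Sum>i<p. ln (f n ((left_shift ^^ i) x)) + 2 * K)"
      by (intro sum_mono) auto
    then show ?thesis
      using \<open>p \<ge> 1\<close> by (simp add: g_def birkhoff_sum_def sum.distrib field_simps)
  qed
  \<comment> \<open>Starting at the \<open>i\<close>-th orbit point, \<open>p - i\<close> steps lead
    back to \<open>x\<close>; then follow the wanted \<open>n\<close> symbols and a remainder of
    \<open>i\<close> symbols.\<close>
  have down: "g (n + p) \<le> ln (f n x) + 2 * K" if "n \<ge> 1" for n
  proof -
    have "ln (f (n + p) ((left_shift ^^ i) x)) \<le> ln (f n x) + 2 * K" if "i < p" for i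
    proof -
      let ?y = "(left_shift ^^ i) x"
      have return: "(left_shift ^^ (p - i)) ?y = x"
        using per \<open>i < p\<close> funpow_add[of "p - i" i left_shift] by simp
      have "ln (f ((p - i) + (n + i)) ?y)
          \<le> C + ln (f (p - i) ?y) + ln (f (n + i) ((left_shift ^^ (p - i)) ?y))"
        using \<open>i < p\<close> \<open>n \<ge> 1\<close> by (intro ln_subadditive[OF X f sub _ _ orb]) auto
      moreover have "C + ln (f (p - i) ?y) \<le> K"
        using \<open>i < p\<close> by (intro K(2)) auto
      moreover have "(p - i) + (n + i) = n + p" using \<open>i < p\<close> by simp
      ultimately have first: "ln (f (n + p) ?y) \<le> ln (f (n + i) x) + K"
        unfolding return by simp
      have "ln (f (n + i) x) \<le> ln (f n x) + K"
      proof (cases "i = 0")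
        case False
        have "ln (f (n + i) x) \<le> C + ln (f n x) + ln (f i ((left_shift ^^ n) x))"
          using False \<open>n \<ge> 1\<close> by (intro ln_subadditive[OF X f sub _ _ x]) auto
        moreover have "(left_shift ^^ n) x = (left_shift ^^ (n mod p)) x"
          by (rule funpow_mod_eq[OF per, symmetric])
        moreover have "C + ln (f i ((left_shift ^^ (n mod p)) x)) \<le> K"
          using False \<open>i < p\<close> by (intro K(2)) (auto simp: less_imp_le)
        ultimately show ?thesis by simp
      qed (use K in simp)
      with first show ?thesis by simp
    qed
    then have "(\<Sum>i<p. ln (f (n + p) ((left_shift ^^ i) x))) \<le> (\<Sum>i<p. ln (f n x) + 2 * K)"
      by (intro sum_mono) auto
    then show ?thesis
      using \<open>p \<ge> 1\<close> by (simp add: g_def birkhoff_sum_def field_simps)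
  qed
  \<comment> \<open>The index is shifted by \<open>p\<close> so that \<open>down\<close> and
    \<open>up\<close> bracket the same term, between \<open>g (n + 2 * p)\<close> and
    \<open>g n\<close>.\<close>
  have "(\<lambda>n. ln (f (n + p) x) / real (n + p)) \<longlonglongrightarrow> L"
  proof (rule tendsto_sandwich)
    show "\<forall>\<^sub>F n in sequentially.
        (g (n + 2 * p) - 2 * K) / real (n + p) \<le> ln (f (n + p) x) / real (n + p)"
      using eventually_ge_at_top[of 1]
    proof eventually_elim
      case (elim n)
      have eq: "n + 2 * p = (n + p) + p" by simp
      have "g (n + 2 * p) - 2 * K \<le> ln (f (n + p) x)"
        unfolding eq using down[of "n + p"] elim by simp
      then show ?case
        by (rule divide_right_mono) simp
    qed
    show "\<forall>\<^sub>F n in sequentially.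
        ln (f (n + p) x) / real (n + p) \<le> (g n + 2 * K) / real (n + p)"
      using eventually_ge_at_top[of 1]
      by eventually_elim (rule divide_right_mono[OF up], simp_all)
    \<comment> \<open>The factor comparing \<open>n + 2 * p\<close> with \<open>n + p\<close> tends
      to 1 and corrects the mismatch of the denominators.\<close>
    have "(\<lambda>n. g (n + 2 * p) / real (n + 2 * p) * (real (n + 2 * p) / real (n + p))
             - 2 * K / real (n + p)) \<longlonglongrightarrow> L * 1 - 0"
      by (intro tendsto_diff tendsto_mult LIMSEQ_ignore_initial_segment[OF g]) real_asymp+
    moreover have "g (n + 2 * p) / real (n + 2 * p) * (real (n + 2 * p) / real (n + p))
        - 2 * K / real (n + p) = (g (n + 2 * p) - 2 * K) / real (n + p)" for n
      using \<open>p \<ge> 1\<close> by (simp add: diff_divide_distrib del: of_nat_add)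
    ultimately show "(\<lambda>n. (g (n + 2 * p) - 2 * K) / real (n + p)) \<longlonglongrightarrow> L"
      by simp
    have "(\<lambda>n. g n / real n * (real n / real (n + p)) + 2 * K / real (n + p)) \<longlonglongrightarrow> L * 1 + 0"
      by (intro tendsto_add tendsto_mult g) real_asymp+
    moreover have "\<forall>\<^sub>F n in sequentially.
        g n / real n * (real n / real (n + p)) + 2 * K / real (n + p)
          = (g n + 2 * K) / real (n + p)"
      using eventually_ge_at_top[of 1]
      by eventually_elim (simp add: add_divide_distrib del: of_nat_add)
    ultimately show "(\<lambda>n. (g n + 2 * K) / real (n + p)) \<longlonglongrightarrow> L"
      by (simp add: tendsto_cong)
  qed
  then have lnf: "(\<lambda>n. ln (f n x) / real n) \<longlonglongrightarrow> L"
    by (rule LIMSEQ_offset)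
  have Sh: "(\<lambda>n. birkhoff_sum h n x / real n) \<longlonglongrightarrow> L"
  proof -
    \<comment> \<open>The deviation from linear growth depends only on \<open>n mod p\<close>,
      because full periods contribute exactly \<open>real p * L\<close>. It is therefore bounded and
      vanishes after division by \<open>n\<close>.\<close>
    define d where "d n = birkhoff_sum h n x - real n * L" for n
    have "d n = d (n mod p)" for n
    proof -
      have "birkhoff_sum h (n div p * p + n mod p) x
          = real (n div p) * (real p * L) + birkhoff_sum h (n mod p) x"
        unfolding birkhoff_sum_add birkhoff_sum_periodic[OF per] funpow_mult_periodic[OF per]
        using \<open>p \<ge> 1\<close> by (simp add: L_def)
      moreover have "real n = real (n div p) * real p + real (n mod p)"
        by (metis div_mult_mod_eq of_nat_add of_nat_mult)
      ultimately show ?thesis by (simp add: d_def algebra_simps)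
    qed
    moreover have "\<bar>d (n mod p)\<bar> \<le> Max ((\<lambda>r. \<bar>d r\<bar>) ` {..<p})" for n
      using \<open>p \<ge> 1\<close> by (intro Max_ge) auto
    ultimately have "\<bar>d n\<bar> \<le> Max ((\<lambda>r. \<bar>d r\<bar>) ` {..<p})" for n
      by metis
    then have "\<forall>\<^sub>F n in sequentially. norm (d n) \<le> Max ((\<lambda>r. \<bar>d r\<bar>) ` {..<p})"
      by simp
    with lim_inverse_n have "(\<lambda>n. inverse (real n) * d n) \<longlonglongrightarrow> 0"
      by (rule lim_null_mult_right_bounded)
    then have "(\<lambda>n. inverse (real n) * d n + L) \<longlonglongrightarrow> 0 + L"
      by (intro tendsto_intros)
    moreover have "\<forall>\<^sub>F n in sequentially. inverse (real n) * d n + L = birkhoff_sum h n x / real n"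
      using eventually_ge_at_top[of 1]
      by eventually_elim (simp add: d_def field_simps)
    ultimately show ?thesis by (simp add: tendsto_cong)
  qed
  have "(\<lambda>n. ln (f n x) / real n - birkhoff_sum h n x / real n) \<longlonglongrightarrow> L - L"
    by (intro tendsto_diff lnf Sh)
  moreover have "\<forall>\<^sub>F n in sequentially. ln (f n x) / real n - birkhoff_sum h n x / real n
      = 1 / real n * ln (f n x / exp (birkhoff_sum h n x))"
    using eventually_ge_at_top[of 1]
    by eventually_elim (simp add: ln_div_exp_birkhoff_sum[OF f _ x] diff_divide_distrib)
  ultimately show ?thesis
    by (simp add: tendsto_cong)
qed


section \<open>Equivalence of the four conditions\<close>

theorem theorem4p1:
  fixes X :: "(nat \<Rightarrow> nat) set"
    and f :: "nat \<Rightarrow> (nat \<Rightarrow> nat) \<Rightarrow> real"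
    and C :: real
    and k N :: nat
    and M :: "nat \<Rightarrow> real"
    and h :: "(nat \<Rightarrow> nat) \<Rightarrow> real"
  assumes "subshift X"
    and "log_sequence_on X f"
    and "tempered_variation_on X f"
    and "C \<ge> 0"
    and "subadditive_on X (\<lambda>n x. exp C * f n x)"
    and "k \<ge> 1" and "N \<ge> 1"
    and "\<And>n. n \<ge> 1 \<Longrightarrow> M n > 0"
    and "(\<lambda>n. 1 / real n * ln (M n)) \<longlonglongrightarrow> 0"
    and "\<And>n u. n \<ge> N \<Longrightarrow> u \<in> words X n \<Longrightarrow>
           \<exists>q\<le>k. \<exists>w\<in>words X q. repeat_word (u @ w) \<in> X \<and>
             (\<forall>j\<ge>1. f (j * (n + q)) (repeat_word (u @ w))
                       \<ge> (M n * (SUP x\<in>cylinder X u. f n x)) ^ j)"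
    and "continuous_on X h"
  shows "let
      i = (asymptotically_additive_on X f \<and>
           (\<lambda>n. 1 / real n * sup_norm_on X (\<lambda>x. ln (f n x / exp (birkhoff_sum h n x))))
             \<longlonglongrightarrow> 0);
      ii = (\<forall>\<mu>\<in>invariant_measures X.
             (\<lambda>n. 1 / real n * (\<integral>x. ln (f n x) \<partial>\<mu>)) \<longlonglongrightarrow> (\<integral>x. h x \<partial>\<mu>) \<and>
             ereal (\<integral>x. h x \<partial>\<mu>) > -\<infinity>);
      iii = (\<forall>x\<in>X. periodic_point x \<longrightarrow>
             (\<lambda>n. 1 / real n * ln (f n x / exp (birkhoff_sum h n x))) \<longlonglongrightarrow> 0);
      iv = (\<forall>x\<in>X.
             (\<lambda>n. 1 / real n * ln (f n x / exp (birkhoff_sum h n x))) \<longlonglongrightarrow> 0)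
    in (i \<longleftrightarrow> ii) \<and> (ii \<longleftrightarrow> iii) \<and> (iii \<longleftrightarrow> iv)"
proof -
  note X = \<open>subshift X\<close> and f = \<open>log_sequence_on X f\<close> and h = \<open>continuous_on X h\<close>
  define E where "E = (\<lambda>n x. ln (f n x / exp (birkhoff_sum h n x)))"
  have E: "E n x = ln (f n x) - birkhoff_sum h n x" if "n \<ge> 1" "x \<in> X" for n x
    unfolding E_def using that by (rule ln_div_exp_birkhoff_sum[OF f])
  have contE: "continuous_on X (E n)" if "n \<ge> 1" for n
    using E[OF that]
    by (subst continuous_on_cong[OF refl])
       (auto intro!: continuous_on_diff continuous_on_ln_log_sequence[OF f that]
          continuous_on_birkhoff_sum[OF X h])
  let ?unif = "\<forall>e>0. \<forall>\<^sub>F n in sequentially. \<forall>x\<in>X. \<bar>ln (f n x) - birkhoff_sum h n x\<bar> \<le> e * real n"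
  let ?sup = "(\<lambda>n. 1 / real n * sup_norm_on X (E n)) \<longlonglongrightarrow> 0"
  let ?ii = "\<forall>\<mu>\<in>invariant_measures X.
    (\<lambda>n. 1 / real n * (\<integral>x. ln (f n x) \<partial>\<mu>)) \<longlonglongrightarrow> (\<integral>x. h x \<partial>\<mu>)"
  let ?iii = "\<forall>x\<in>X. periodic_point x \<longrightarrow> (\<lambda>n. 1 / real n * E n x) \<longlonglongrightarrow> 0"
  let ?iv = "\<forall>x\<in>X. (\<lambda>n. 1 / real n * E n x) \<longlonglongrightarrow> 0"
  have sup_imp_unif: ?unif if ?sup
  proof (intro allI impI)
    fix e :: real assume "e > 0"
    have "\<forall>\<^sub>F n in sequentially. dist (1 / real n * sup_norm_on X (E n)) 0 < e"
      using that \<open>e > 0\<close> by (rule tendstoD)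
    then show "\<forall>\<^sub>F n in sequentially. \<forall>x\<in>X. \<bar>ln (f n x) - birkhoff_sum h n x\<bar> \<le> e * real n"
      using eventually_ge_at_top[of 1]
    proof eventually_elim
      case (elim n)
      then have "sup_norm_on X (E n) \<le> e * real n"
        by (simp add: field_simps)
      then show ?case
        using abs_le_sup_norm_on[OF X contE[OF elim(2)]] E[OF elim(2)] by fastforce
    qed
  qed
  have unif_E: "\<forall>\<^sub>F n in sequentially. \<forall>x\<in>X. \<bar>E n x\<bar> \<le> e * real n" if ?unif "e > 0" for e
    using that(1)[rule_format, OF that(2)] eventually_ge_at_top[of 1]
    by eventually_elim (simp add: E)
  have unif_imp_sup: ?sup if ?unif
    by (rule sup_norm_on_average_tendsto_0[OF unif_E[OF that]])
  have asym: "asymptotically_additive_on X f" if ?sup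
    unfolding asymptotically_additive_on_def
  \<comment> \<open>The same function \<open>h\<close> serves as \<open>\<rho>\<close> for every
    \<open>\<epsilon>\<close>; the witness left open by \<open>exI\<close> is fixed by the
    \<open>show\<close> about the upper limit.\<close>
  proof (intro allI impI exI conjI)
    fix \<epsilon> :: real assume "\<epsilon> > 0"
    have "\<forall>\<^sub>F n in sequentially. 1 / real n * sup_norm_on X (E n)
        = 1 / real n * sup_norm_on X (\<lambda>x. ln (f n x) - birkhoff_sum h n x)"
      using eventually_ge_at_top[of 1]
      by eventually_elim (simp add: sup_norm_on_def E cong: SUP_cong)
    with that have "(\<lambda>n. 1 / real n * sup_norm_on X (\<lambda>x. ln (f n x) - birkhoff_sum h n x)) \<longlonglongrightarrow> 0"
      by (rule Lim_transform_eventually)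
    then have "limsup (\<lambda>n. ereal (1 / real n * sup_norm_on X (\<lambda>x. ln (f n x) - birkhoff_sum h n x)))
        = ereal 0"
      by (intro lim_imp_Limsup) (auto simp: lim_ereal)
    then show "limsup (\<lambda>n. ereal (1 / real n * sup_norm_on X (\<lambda>x. ln (f n x) - birkhoff_sum h n x)))
        < ereal \<epsilon>"
      using \<open>\<epsilon> > 0\<close> by simp
  qed (rule h)
  have unif_imp_iv: ?iv if ?unif
  proof (intro ballI tendstoI)
    fix x and e :: real assume "x \<in> X" "e > 0"
    then have "e / 2 > 0" by simp
    from unif_E[OF that this] eventually_ge_at_top[of 1]
    show "\<forall>\<^sub>F n in sequentially. dist (1 / real n * E n x) 0 < e"
    proof eventually_elim
      case (elim n)
      then have "\<bar>E n x\<bar> \<le> e / 2 * real n" using \<open>x \<in> X\<close> by blast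
      also have "\<dots> < e * real n" using elim \<open>e > 0\<close> by simp
      finally show ?case using elim by (simp add: field_simps)
    qed
  qed
  have unif_imp_ii: ?ii if ?unif
    using that by (intro ballI uniform_imp_integral_limit[OF X f h]) auto
  have ii_imp_iii: ?iii if ?ii
  proof (intro ballI impI)
    fix x assume x: "x \<in> X" "periodic_point x"
    then obtain p where p: "p \<ge> 1" "(left_shift ^^ p) x = x"
      by (auto simp: periodic_point_def)
    show "(\<lambda>n. 1 / real n * E n x) \<longlonglongrightarrow> 0"
      unfolding E_def
      by (intro integral_limit_imp_periodic_limit[OF X f assms(5) h x(1) p]
            that[rule_format] orbit_measure_invariant[OF X x(1) p])
  qed
  have iii_imp_unif: ?unif if ?iii
    using that unfolding E_def
    by (intro allI impI periodic_limits_imp_uniform[OF X f assms(3,4,5,8,9,10) h]) auto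
  \<comment> \<open>\<open>?sup\<close> and \<open>?unif\<close> imply each other and
    \<open>?sup\<close> gives asymptotic additivity. The remaining implications lead from
    \<open>?unif\<close> to \<open>?ii\<close> and \<open>?iv\<close>, from either of these to
    \<open>?iii\<close> (from \<open>?iv\<close> by restriction to periodic points), and back to
    \<open>?unif\<close>.\<close>
  have "(asymptotically_additive_on X f \<and> ?sup \<longleftrightarrow> ?ii) \<and> (?ii \<longleftrightarrow> ?iii) \<and> (?iii \<longleftrightarrow> ?iv)"
    using sup_imp_unif unif_imp_sup asym unif_imp_iv unif_imp_ii ii_imp_iii iii_imp_unif by blast
  then show ?thesis
    unfolding E_def Let_def by simp
qed

end
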